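(* Let $(c_n)\in\ell^2_{\mathbb{R}}$, let $(p_n)_0\in\Delta$, and let $t\mapsto(p_n)(t)$ be a smooth curve in $\Delta$ with initial value $(p_n)(0)=(p_n)_0$. Then $t\mapsto(p_n)(t)$ is the gradient flow line of $$F_{(c_n)}:\Delta\to\mathbb{R},\qquad F_{(c_n)}((p_n))=\langle(c_n),(p_n)\rangle_{\ell^2},$$ on $(\Delta,\mathcal{G}^{\mathrm{FR}})$ with initial value $(p_n)_0$ if and only if it is an $e$-geodesic of $(\Delta,\nabla^{(e)})$ with initial values $((p_n)_0,(v_n))$ for some $(v_n)\in T_{(p_n)_0}\Delta$ such that there exists $\lambda\in\mathbb{R}$ satisfying $$c_n=\frac{v_n}{(p_n)_0}+\lambda\qquad\forall n\in\mathbb{N},$$ where $(p_n)_0$ in the denominator denotes the $n$-th entry $p_n(0)$ of the initial value.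
   Context: $\ell^2_{\mathbb{R}}$ is the real Hilbert space of square-summable real sequences $(x_n)_{n\in\mathbb{N}}$ (indices start at $0$), with inner product $\langle(x_n),(y_n)\rangle_{\ell^2}=\sum_{n=0}^\infty x_ny_n$; $\mathbb{S}(\ell^2_{\mathbb{R}})$ is its unit sphere and $\mathcal{U}:=\{(x_n)\in\mathbb{S}(\ell^2_{\mathbb{R}}):x_n>0\ \forall n\in\mathbb{N}\}$, regarded as an open subset of the sphere. The $\ell^2$-probability simplex is $\Delta:=\{(p_n)\in\ell^1_{\mathbb{R}}:\sum_{n=0}^\infty p_n=1,\ p_n>0\ \forall n\in\mathbb{N}\}$, equipped with the differentiable structure for which the homeomorphism $\Phi:\Delta\to\mathcal{U}$, $(p_n)\mapsto(\sqrt{p_n})$, becomes a diffeomorphism. With respect to it, $$T_{(p_n)}\Delta=\Big\{(v_n)\in\ell^1_{\mathbb{R}}:\sum_{n=0}^\infty v_n=0\ \text{and}\ \Big(\tfrac{v_n}{\sqrt{p_n}}\Big)\in\ell^2_{\mathbb{R}}\Big\}.$$ The $\ell^2$-Fisher--Rao metric is $$\mathcal{G}^{\mathrm{FR}}_{(p_n)}((v_n),(w_n)):=\frac14\sum_{n=0}^\infty\frac{v_n\cdot w_n}{p_n},\qquad (v_n),(w_n)\in T_{(p_n)}\Delta.$$ A gradient flow line of $F_{(c_n)}$ on $(\Delta,\mathcal{G}^{\mathrm{FR}})$ is an integral curve of the gradient vector field of $F_{(c_n)}$ with respect to $\mathcal{G}^{\mathrm{FR}}$. The $e$-connection $\nabla^{(e)}$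 on $\Delta$ is defined for vector fields $(V_n),(W_n)$ on $\Delta$, at each $(p_n)\in\Delta$, by $$\big(\nabla^{(e)}_{(V_n)}(W_n)\big)_n\Big|_{(p_n)}:=p_n\left(D_{(V_n)}\Big(\frac{W_n}{p_n}\Big)-\sum_{k=0}^{\infty}p_k\,D_{(V_n)}\Big(\frac{W_k}{p_k}\Big)\right)\Bigg|_{(p_n)},$$ where $D_{(V_n)}$ is the directional derivative along $(V_n)$. A smooth curve $t\mapsto(p_n)(t)$ in $\Delta$ defined on an interval is an $e$-geodesic of $(\Delta,\nabla^{(e)})$ if $\nabla^{(e)}_{(\dot p_n)}(\dot p_n)=0$, where along the curve $$\big(\nabla^{(e)}_{\dot p}\dot p\big)_n=p_n\left(\frac{d}{dt}\Big(\frac{\dot p_n}{p_n}\Big)-\sum_{k=0}^{\infty}p_k\frac{d}{dt}\Big(\frac{\dot p_k}{p_k}\Big)\right).$$ Its initial values are the position $(p_n)(0)$ and velocity $(\dot p_n)(0)$ at $t=0$.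
   Formalization: The linking relation is corrected to c_n = v_n/(4 p_n(0)) + λ: with the factor 1/4 in the Fisher–Rao metric the printed relation c_n = v_n/p_n(0) + λ makes the equivalence false for every nonzero (c_n). *)

theory Defs
  imports "HOL-Analysis.Analysis"
begin

section \<open>The real Hilbert space of square-summable sequences\<close>

typedef ell2 = "{x :: nat \<Rightarrow> real. summable (\<lambda>n. (x n)\<^sup>2)}"
  morphisms seq Abs_ell2
  by (rule exI[of _ "\<lambda>_. 0"]) simp

lemma seq_summable: "summable (\<lambda>n. (seq x n)\<^sup>2)"
  using seq[of x] by simp

lemma ell2_add_summable:
  fixes x y :: "nat \<Rightarrow> real"
  assumes "summable (\<lambda>n. (x n)\<^sup>2)" "summable (\<lambda>n. (y n)\<^sup>2)"
  shows "summable (\<lambda>n. (x n + y n)\<^sup>2)"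
proof (rule summable_comparison_test')
  show "summable (\<lambda>n. 2 * (x n)\<^sup>2 + 2 * (y n)\<^sup>2)"
    by (intro summable_add summable_mult assms)
  fix n :: nat
  have "0 \<le> (x n - y n)\<^sup>2" by simp
  then have "(x n + y n)\<^sup>2 \<le> 2 * (x n)\<^sup>2 + 2 * (y n)\<^sup>2"
    by (simp add: power2_eq_square algebra_simps)
  then show "norm ((x n + y n)\<^sup>2) \<le> 2 * (x n)\<^sup>2 + 2 * (y n)\<^sup>2"
    by simp
qed

lemma ell2_scale_summable:
  fixes x :: "nat \<Rightarrow> real"
  assumes "summable (\<lambda>n. (x n)\<^sup>2)"
  shows "summable (\<lambda>n. (r * x n)\<^sup>2)"
  using summable_mult[OF assms, of "r\<^sup>2"] by (simp add: power_mult_distrib)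

lemma ell2_mult_summable:
  fixes x y :: "nat \<Rightarrow> real"
  assumes "summable (\<lambda>n. (x n)\<^sup>2)" "summable (\<lambda>n. (y n)\<^sup>2)"
  shows "summable (\<lambda>n. x n * y n)"
proof (rule summable_comparison_test')
  show "summable (\<lambda>n. (x n)\<^sup>2 + (y n)\<^sup>2)"
    by (intro summable_add assms)
  fix n :: nat
  have "0 \<le> (\<bar>x n\<bar> - \<bar>y n\<bar>)\<^sup>2" by simp
  then have "2 * (\<bar>x n\<bar> * \<bar>y n\<bar>) \<le> (x n)\<^sup>2 + (y n)\<^sup>2"
    by (simp add: power2_diff)
  moreover have "0 \<le> \<bar>x n\<bar> * \<bar>y n\<bar>" by simp
  ultimately have "\<bar>x n\<bar> * \<bar>y n\<bar> \<le> (x n)\<^sup>2 + (y n)\<^sup>2"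
    by linarith
  then show "norm (x n * y n) \<le> (x n)\<^sup>2 + (y n)\<^sup>2"
    by (simp add: abs_mult)
qed

instantiation ell2 :: real_vector
begin

definition "0 = Abs_ell2 (\<lambda>_. 0)"
definition "x + y = Abs_ell2 (\<lambda>n. seq x n + seq y n)"
definition "- x = Abs_ell2 (\<lambda>n. - seq x n)"
definition "x - y = Abs_ell2 (\<lambda>n. seq x n - seq y n)"
definition "r *\<^sub>R x = Abs_ell2 (\<lambda>n. r * seq x n)"

lemma seq_zero: "seq 0 n = 0"
  by (simp add: zero_ell2_def Abs_ell2_inverse)

lemma seq_plus: "seq (x + y) n = seq x n + seq y n"
  using ell2_add_summable[OF seq_summable[of x] seq_summable[of y]]
  by (simp add: plus_ell2_def Abs_ell2_inverse)

lemma seq_uminus: "seq (- x) n = - seq x n"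
  using seq_summable[of x] by (simp add: uminus_ell2_def Abs_ell2_inverse)

lemma seq_minus: "seq (x - y) n = seq x n - seq y n"
  using ell2_add_summable[OF seq_summable[of x], of "\<lambda>n. - seq y n"] seq_summable[of y]
  by (simp add: minus_ell2_def Abs_ell2_inverse)

lemma seq_scaleR: "seq (r *\<^sub>R x) n = r * seq x n"
  using ell2_scale_summable[OF seq_summable[of x]]
  by (simp add: scaleR_ell2_def Abs_ell2_inverse)

lemmas seq_simps = seq_zero seq_plus seq_uminus seq_minus seq_scaleR

instance
  by standard (auto simp: seq_inject[symmetric] fun_eq_iff seq_simps algebra_simps)

end

instantiation ell2 :: real_inner
begin

definition "x \<bullet> y = (\<Sum>n. seq x n * seq y n)"
definition "norm (x::ell2) = sqrt (x \<bullet> x)"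
definition "dist (x::ell2) y = norm (x - y)"
definition "sgn (x::ell2) = x /\<^sub>R norm x"
definition [code del]:
  "(uniformity :: (ell2 \<times> ell2) filter) = (INF e\<in>{0<..}. principal {(x, y). dist x y < e})"
definition [code del]:
  "open (U :: ell2 set) \<longleftrightarrow> (\<forall>x\<in>U. eventually (\<lambda>(x', y). x' = x \<longrightarrow> y \<in> U) uniformity)"

instance
proof
  fix x y z :: ell2 and r :: real
  show "x \<bullet> y = y \<bullet> x"
    by (simp add: inner_ell2_def mult.commute)
  show "(x + y) \<bullet> z = x \<bullet> z + y \<bullet> z"
    by (simp add: inner_ell2_def seq_simps distrib_right suminf_add
        ell2_mult_summable seq_summable)
  show "r *\<^sub>R x \<bullet> y = r * (x \<bullet> y)"
    using suminf_mult[OF ell2_mult_summable[OF seq_summable[of x] seq_summable[of y]], of r]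
    by (simp add: inner_ell2_def seq_simps mult.assoc)
  show "0 \<le> x \<bullet> x"
    unfolding inner_ell2_def
    by (intro suminf_nonneg ell2_mult_summable seq_summable) simp
  have "x \<bullet> x = (\<Sum>n. (seq x n)\<^sup>2)"
    by (simp add: inner_ell2_def power2_eq_square)
  then have "x \<bullet> x = 0 \<longleftrightarrow> (\<forall>n. (seq x n)\<^sup>2 = 0)"
    using suminf_eq_zero_iff[OF seq_summable[of x]] by simp
  then show "x \<bullet> x = 0 \<longleftrightarrow> x = 0"
    by (auto simp: seq_inject[symmetric] fun_eq_iff seq_simps)
qed (rule norm_ell2_def dist_ell2_def sgn_ell2_def uniformity_ell2_def open_ell2_def)+

end


section \<open>Smooth curves\<close>

text \<open>Derivatives at the end points of \<open>I\<close> that belong to \<open>I\<close> are one-sided.\<close>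

definition smooth_on_interval :: "real set \<Rightarrow> (real \<Rightarrow> 'a::real_normed_vector) \<Rightarrow> bool" where
  "smooth_on_interval I x \<longleftrightarrow>
     (\<exists>D. (\<forall>t\<in>I. D 0 t = x t) \<and>
          (\<forall>k::nat. \<forall>t\<in>I. (D k has_vector_derivative D (Suc k) t) (at t within I)))"


section \<open>The simplex and its Fisher--Rao geometry\<close>

definition l2_simplex :: "(nat \<Rightarrow> real) set" where
  "l2_simplex = {p. summable (\<lambda>n. \<bar>p n\<bar>) \<and> (\<Sum>n. p n) = 1 \<and> (\<forall>n. p n > 0)}"

definition sqrt_chart :: "(nat \<Rightarrow> real) \<Rightarrow> ell2" where
  "sqrt_chart p = Abs_ell2 (\<lambda>n. sqrt (p n))"

text \<open>
  The differentiable structure of the simplex is the one transported from the unit sphere of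
  \<open>\<ell>\<^sup>2\<close> by \<open>sqrt_chart\<close>.  The image of \<open>sqrt_chart\<close> has empty interior in the
  sphere (a small perturbation can make a far-out entry negative), so smoothness of a curve means
  smoothness in the sphere, equivalently in the ambient Hilbert space.
\<close>

definition smooth_curve :: "real set \<Rightarrow> (real \<Rightarrow> nat \<Rightarrow> real) \<Rightarrow> bool" where
  "smooth_curve I p \<longleftrightarrow>
     (\<forall>t\<in>I. p t \<in> l2_simplex) \<and> smooth_on_interval I (\<lambda>t. sqrt_chart (p t))"

definition tangent_space :: "(nat \<Rightarrow> real) \<Rightarrow> (nat \<Rightarrow> real) set" where
  "tangent_space p = {v. summable (\<lambda>n. \<bar>v n\<bar>) \<and> (\<Sum>n. v n) = 0 \<and>
                         summable (\<lambda>n. (v n / sqrt (p n))\<^sup>2)}"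

definition fisher_rao :: "(nat \<Rightarrow> real) \<Rightarrow> (nat \<Rightarrow> real) \<Rightarrow> (nat \<Rightarrow> real) \<Rightarrow> real" where
  "fisher_rao p v w = 1/4 * (\<Sum>n. v n * w n / p n)"

text \<open>
  Evaluation of a smooth curve at a single coordinate is smooth, so its velocity may be computed
  coordinatewise.
\<close>

definition velocity :: "real set \<Rightarrow> (real \<Rightarrow> nat \<Rightarrow> real) \<Rightarrow> real \<Rightarrow> nat \<Rightarrow> real" where
  "velocity I p t n = vector_derivative (\<lambda>s. p s n) (at t within I)"


section \<open>Gradient flow lines\<close>

text \<open>
  The gradient represents the differential with respect to the Fisher--Rao metric.  The
  differential of \<open>F\<close> at \<open>p\<close> is evaluated at a tangent vector \<open>w\<close> as a directional derivative.
  The segment \<open>p + s w\<close> may leave the simplex for every \<open>s \<noteq> 0\<close>, since \<open>w n / p n\<close> can be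
  unbounded, but it stays in \<open>\<ell>\<^sup>1\<close>; so \<open>F\<close> has to be given by its formula there.
\<close>

definition is_gradient ::
    "((nat \<Rightarrow> real) \<Rightarrow> real) \<Rightarrow> (nat \<Rightarrow> real) \<Rightarrow> (nat \<Rightarrow> real) \<Rightarrow> bool" where
  "is_gradient F p g \<longleftrightarrow> g \<in> tangent_space p \<and>
     (\<forall>w\<in>tangent_space p.
        ((\<lambda>s. F (\<lambda>n. p n + s * w n)) has_real_derivative fisher_rao p g w) (at 0))"

definition gradient_flow_line ::
    "((nat \<Rightarrow> real) \<Rightarrow> real) \<Rightarrow> real set \<Rightarrow> (nat \<Rightarrow> real) \<Rightarrow> (real \<Rightarrow> nat \<Rightarrow> real) \<Rightarrow> bool" where
  "gradient_flow_line F I p0 p \<longleftrightarrow>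
     p 0 = p0 \<and> (\<forall>t\<in>I. is_gradient F (p t) (velocity I p t))"

text \<open>
  \<open>Abs_ell2\<close> is only applied to elements of \<open>\<ell>\<^sup>1\<close>, which are square-summable.  Because of the
  factor \<open>1/4\<close> in the metric, the gradient of \<open>linear_functional c\<close> at \<open>p\<close> is
  \<open>4 p n (c n - \<langle>c,p\<rangle>)\<close>; so a flow line has initial velocity \<open>v\<close> with
  \<open>c n = v n / (4 p n) + const\<close>.
\<close>

definition linear_functional :: "ell2 \<Rightarrow> (nat \<Rightarrow> real) \<Rightarrow> real" where
  "linear_functional c p = c \<bullet> Abs_ell2 p"


section \<open>Geodesics of the e-connection\<close>

text \<open>
  \<open>e_acceleration\<close> is the e-covariant derivative of the velocity along the curve.  With
  \<open>x n = sqrt (p n)\<close>, the sum has the terms \<open>2 (x n x''n - (x'n)\<^sup>2)\<close>, so it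
  converges for smooth curves.
\<close>

definition e_acceleration :: "real set \<Rightarrow> (real \<Rightarrow> nat \<Rightarrow> real) \<Rightarrow> real \<Rightarrow> nat \<Rightarrow> real" where
  "e_acceleration I p t n =
     (let D = (\<lambda>k. vector_derivative (\<lambda>s. velocity I p s k / p s k) (at t within I))
      in p t n * (D n - (\<Sum>k. p t k * D k)))"

definition e_geodesic ::
    "real set \<Rightarrow> (nat \<Rightarrow> real) \<Rightarrow> (nat \<Rightarrow> real) \<Rightarrow> (real \<Rightarrow> nat \<Rightarrow> real) \<Rightarrow> bool" where
  "e_geodesic I p0 v p \<longleftrightarrow>
     p 0 = p0 \<and> velocity I p 0 = v \<and> (\<forall>t\<in>I. \<forall>n. e_acceleration I p t n = 0)"

end

theory Submission
  imports Defs
begin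

text \<open>
  Testing the gradient condition against differences of two unit vectors shows that \<open>g\<close> is the
  gradient of \<open>\<langle>c,\<cdot>\<rangle>\<close> at \<open>p\<close> iff \<open>g\<close> is tangent and \<open>g\<^sub>n / (4 p\<^sub>n) - c\<^sub>n\<close> does not depend on
  \<open>n\<close>.  A curve is an e-geodesic iff the derivative of \<open>v\<^sub>n / p\<^sub>n\<close> does not depend on \<open>n\<close>,
  that is, iff the differences \<open>v\<^sub>n / p\<^sub>n - v\<^sub>m / p\<^sub>m\<close> are constant along the curve; so the
  gradient condition at time \<open>0\<close> propagates to all times.
\<close>

section \<open>Coordinates of square-summable sequences\<close>

lemma inner_ell2_sums: "(\<lambda>n. seq x n * seq y n) sums (x \<bullet> y)"
  unfolding inner_ell2_def
  by (intro summable_sums ell2_mult_summable seq_summable)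

lemma abs_seq_le_norm: "\<bar>seq x n\<bar> \<le> norm x"
proof -
  have "(seq x n)\<^sup>2 \<le> x \<bullet> x"
    using sum_le_suminf[OF seq_summable[of x], of "{n}"]
    by (simp add: inner_ell2_def power2_eq_square)
  then show ?thesis
    by (simp add: norm_ell2_def real_le_rsqrt)
qed

text \<open>Derivatives in \<open>ell2\<close> pass to single coordinates through this, so
  velocities can be computed entry by entry.\<close>

lemma bounded_linear_seq: "bounded_linear (\<lambda>x. seq x n)"
  by (rule bounded_linear_intro[where K = 1]) (simp_all add: seq_simps abs_seq_le_norm)

text \<open>The terms tend to 0, so their squares are eventually dominated by them. This makes
  \<open>Abs_ell2\<close> meaningful on absolutely summable sequences.\<close>

lemma summable_power2_of_summable_abs:
  fixes x :: "nat \<Rightarrow> real"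
  assumes "summable (\<lambda>n. \<bar>x n\<bar>)"
  shows "summable (\<lambda>n. (x n)\<^sup>2)"
proof (rule summable_comparison_test_ev[OF _ assms])
  have "(\<lambda>n. \<bar>x n\<bar>) \<longlonglongrightarrow> 0"
    using assms by (rule summable_LIMSEQ_zero)
  then have "eventually (\<lambda>n. \<bar>x n\<bar> < 1) sequentially"
    by (rule order_tendstoD) simp
  then show "eventually (\<lambda>n. norm ((x n)\<^sup>2) \<le> \<bar>x n\<bar>) sequentially"
  proof (rule eventually_mono)
    fix n assume "\<bar>x n\<bar> < 1"
    then have "\<bar>x n\<bar> * \<bar>x n\<bar> \<le> \<bar>x n\<bar> * 1"
      by (intro mult_left_mono) simp_all
    then show "norm ((x n)\<^sup>2) \<le> \<bar>x n\<bar>"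
      by (simp add: power2_eq_square abs_mult)
  qed
qed

lemma seq_Abs_ell2_of_summable_abs:
  "summable (\<lambda>n. \<bar>x n\<bar>) \<Longrightarrow> seq (Abs_ell2 x) = x"
  by (simp add: Abs_ell2_inverse summable_power2_of_summable_abs)

lemma linear_functional_sums:
  assumes "summable (\<lambda>n. \<bar>x n\<bar>)"
  shows "(\<lambda>n. seq c n * x n) sums linear_functional c x"
  using inner_ell2_sums[of c "Abs_ell2 x"] assms
  by (simp add: linear_functional_def seq_Abs_ell2_of_summable_abs)

section \<open>Tangent vectors and gradients\<close>

lemma l2_simplexD:
  assumes "p \<in> l2_simplex"
  shows "summable (\<lambda>n. \<bar>p n\<bar>)" "p sums 1" "p n > 0"
  using assms by (auto simp: l2_simplex_def sums_iff intro: summable_rabs_cancel)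

lemma tangent_spaceD:
  assumes "w \<in> tangent_space p"
  shows "summable (\<lambda>n. \<bar>w n\<bar>)" "w sums 0" "summable (\<lambda>n. (w n / sqrt (p n))\<^sup>2)"
  using assms by (auto simp: tangent_space_def sums_iff intro: summable_rabs_cancel)

text \<open>The segment stays absolutely summable, and on it the functional is affine in
  \<open>s\<close>.\<close>

lemma linear_functional_derivative:
  assumes p: "summable (\<lambda>n. \<bar>p n\<bar>)" and w: "summable (\<lambda>n. \<bar>w n\<bar>)"
  shows "((\<lambda>s. linear_functional c (\<lambda>n. p n + s * w n)) has_real_derivative
    linear_functional c w) (at 0)"
proof -
  have "linear_functional c (\<lambda>n. p n + s * w n) =
      linear_functional c p + s * linear_functional c w" for s
  proof -
    have "summable (\<lambda>n. \<bar>p n + s * w n\<bar>)"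
    proof (rule summable_comparison_test')
      show "summable (\<lambda>n. \<bar>p n\<bar> + \<bar>s\<bar> * \<bar>w n\<bar>)"
        by (intro summable_add summable_mult p w)
      show "norm \<bar>p n + s * w n\<bar> \<le> \<bar>p n\<bar> + \<bar>s\<bar> * \<bar>w n\<bar>" for n
        using abs_triangle_ineq[of "p n" "s * w n"] by (simp add: abs_mult)
    qed
    then have "(\<lambda>n. seq c n * (p n + s * w n)) sums linear_functional c (\<lambda>n. p n + s * w n)"
      by (rule linear_functional_sums)
    moreover have "(\<lambda>n. seq c n * p n + s * (seq c n * w n)) sums
        (linear_functional c p + s * linear_functional c w)"
      by (intro sums_add sums_mult linear_functional_sums p w)
    ultimately show ?thesis
      by (simp add: sums_iff algebra_simps)
  qed
  then show ?thesis
    by (auto intro!: derivative_eq_intros)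
qed

text \<open>The constant \<open>l\<close> is the freedom left by testing only against sequences with
  sum 0.\<close>

lemma is_gradient_linear_functional_iff:
  assumes p: "p \<in> l2_simplex"
  shows "is_gradient (linear_functional c) p g \<longleftrightarrow>
    g \<in> tangent_space p \<and> (\<exists>l. \<forall>n. seq c n = g n / (4 * p n) + l)"
proof -
  have "((\<lambda>s. linear_functional c (\<lambda>n. p n + s * w n)) has_real_derivative d) (at 0) \<longleftrightarrow>
      d = linear_functional c w" if "w \<in> tangent_space p" for w d
    using linear_functional_derivative[OF l2_simplexD(1)[OF p] tangent_spaceD(1)[OF that], of c]
    by (auto dest: DERIV_unique)
  then have "is_gradient (linear_functional c) p g \<longleftrightarrow> g \<in> tangent_space p \<and>
      (\<forall>w\<in>tangent_space p. fisher_rao p g w = linear_functional c w)"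
    by (simp add: is_gradient_def cong: conj_cong)
  moreover have "\<exists>l. \<forall>n. seq c n = g n / (4 * p n) + l"
    if g: "\<And>w. w \<in> tangent_space p \<Longrightarrow> fisher_rao p g w = linear_functional c w"
  proof (intro exI allI)
    fix n
    \<comment> \<open>The case \<open>n = 0\<close> forces this value of \<open>l\<close>.\<close>
    show "seq c n = g n / (4 * p n) + (seq c 0 - g 0 / (4 * p 0))"
    proof (cases "n = 0")
      case False
      \<comment> \<open>Finite support makes this vector tangent at every \<open>p\<close>, and
        pairing with it isolates the entries at \<open>n\<close> and 0.\<close>
      define w :: "nat \<Rightarrow> real" where "w = (\<lambda>k. if k = n then 1 else if k = 0 then -1 else 0)"
      have sums: "(\<lambda>k. w k * a k) sums (a n - a 0)" for a :: "nat \<Rightarrow> real"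
        using sums_finite[of "{0, n}" "\<lambda>k. w k * a k"] False by (simp add: w_def)
      have "summable (\<lambda>k. \<bar>w k\<bar>)" "summable (\<lambda>k. (w k / sqrt (p k))\<^sup>2)"
        by (rule summable_finite[of "{0, n}"]; simp add: w_def)+
      with sums[of "\<lambda>_. 1"] have w: "w \<in> tangent_space p"
        by (simp add: tangent_space_def sums_iff)
      have "linear_functional c w = seq c n - seq c 0"
        using linear_functional_sums[OF tangent_spaceD(1)[OF w], of c] sums[of "seq c"]
        by (simp add: sums_iff mult.commute)
      moreover have "fisher_rao p g w = 1/4 * (g n / p n - g 0 / p 0)"
        using sums[of "\<lambda>k. g k / p k"] by (simp add: fisher_rao_def sums_iff mult.commute)
      ultimately show ?thesis
        using g[OF w] by (simp add: algebra_simps)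
    qed simp
  qed
  moreover have "fisher_rao p g w = linear_functional c w"
    if l: "\<forall>n. seq c n = g n / (4 * p n) + l" and w: "w \<in> tangent_space p" for l w
  proof -
    \<comment> \<open>Since \<open>w\<close> has sum 0, subtracting \<open>l * w n\<close> does not
      change the sum. Up to the factor 4 the new terms are those of the metric, whose series
      therefore converges.\<close>
    have "(\<lambda>n. seq c n * w n - l * w n) sums (linear_functional c w - l * 0)"
      by (intro sums_diff sums_mult linear_functional_sums tangent_spaceD[OF w])
    then have "(\<lambda>n. 4 * (seq c n * w n - l * w n)) sums (4 * linear_functional c w)"
      by (intro sums_mult) simp
    moreover have "4 * (seq c n * w n - l * w n) = g n * w n / p n" for n
      using l by (simp add: algebra_simps)
    ultimately show ?thesis
      by (simp add: fisher_rao_def sums_iff)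
  qed
  ultimately show ?thesis
    by blast
qed

section \<open>Smooth curves in the simplex\<close>

text \<open>A connected set with two points has no isolated point. Hence derivatives within the
  interval, one-sided at end points, are unique.\<close>

lemma at_within_interval_neq_bot:
  fixes I :: "real set"
  assumes "is_interval I" "s \<in> I" "u \<in> I" "s \<noteq> u" "t \<in> I"
  shows "at t within I \<noteq> bot"
  using connected_imp_perfect[of I t] assms
  by (auto simp: is_interval_connected_1 trivial_limit_within)

text \<open>
  With \<open>x = sqrt_chart p\<close>, the velocity of \<open>p\<close> is \<open>2 x x'\<close>; its sum vanishes because \<open>x\<close> stays
  on the unit sphere.
\<close>

lemma smooth_curve_velocity:
  assumes curve: "smooth_curve I p" and I: "\<And>t. t \<in> I \<Longrightarrow> at t within I \<noteq> bot"
    and t: "t \<in> I"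
  shows "velocity I p t \<in> tangent_space (p t)"
    and "(\<lambda>s. velocity I p s n / p s n) differentiable (at t within I)"
proof -
  define x where "x = (\<lambda>t. sqrt_chart (p t))"
  have simplex: "p s \<in> l2_simplex" if "s \<in> I" for s
    using curve that by (simp add: smooth_curve_def)
  from curve obtain D where D0: "\<And>s. s \<in> I \<Longrightarrow> D 0 s = x s"
    and D: "\<And>k s. s \<in> I \<Longrightarrow> (D k has_vector_derivative D (Suc k) s) (at s within I)"
    unfolding smooth_curve_def smooth_on_interval_def x_def by blast
  have coord: "((\<lambda>s. seq (D k s) n) has_real_derivative seq (D (Suc k) s) n) (at s within I)"
    if "s \<in> I" for k n s
    using bounded_linear.has_vector_derivative[OF bounded_linear_seq D[OF that]]
    by (simp add: has_real_derivative_iff_has_vector_derivative)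
  have seq_D0: "seq (D 0 s) n = sqrt (p s n)" if "s \<in> I" for s n
  proof -
    have "summable (\<lambda>n. (sqrt (p s n))\<^sup>2)"
      using l2_simplexD[OF simplex[OF that]] by (simp add: sums_iff less_imp_le)
    then show ?thesis
      by (simp add: D0 that x_def sqrt_chart_def Abs_ell2_inverse)
  qed
  have p_eq: "p s n = (seq (D 0 s) n)\<^sup>2" and pos: "seq (D 0 s) n > 0" if "s \<in> I" for s n
    using l2_simplexD(3)[OF simplex[OF that], of n] that by (simp_all add: seq_D0)
  have velocity: "velocity I p s n = 2 * (seq (D 0 s) n * seq (D 1 s) n)" if s: "s \<in> I" for s n
  proof -
    have "((\<lambda>s. (seq (D 0 s) n)\<^sup>2) has_real_derivative
        2 * (seq (D 0 s) n * seq (D 1 s) n)) (at s within I)"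
      using coord[OF s, of 0] by (auto intro!: derivative_eq_intros)
    then have "((\<lambda>s. p s n) has_real_derivative
        2 * (seq (D 0 s) n * seq (D 1 s) n)) (at s within I)"
      by (rule has_field_derivative_transform_within[OF _ zero_less_one s]) (simp add: p_eq)
    then show ?thesis
      unfolding velocity_def
      by (intro vector_derivative_within I s)
        (simp add: has_real_derivative_iff_has_vector_derivative)
  qed
  show "velocity I p t \<in> tangent_space (p t)"
  proof -
    have "D 0 s \<bullet> D 0 s = 1" if "s \<in> I" for s
      using inner_ell2_sums[of "D 0 s" "D 0 s"] l2_simplexD(2)[OF simplex[OF that]]
      by (simp add: sums_iff p_eq[OF that, abs_def] power2_eq_square)
    moreover have "((\<lambda>s. D 0 s \<bullet> D 0 s) has_vector_derivative 2 * (D 0 t \<bullet> D 1 t)) (at t within I)"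
      using bounded_bilinear.has_vector_derivative[OF bounded_bilinear_inner D[OF t, of 0] D[OF t, of 0]]
      by (simp add: inner_commute)
    \<comment> \<open>The constant function 1 also has derivative 0, so uniqueness gives
      orthogonality of \<open>D 0 t\<close> and \<open>D 1 t\<close>.\<close>
    ultimately have "((\<lambda>_. 1) has_vector_derivative 2 * (D 0 t \<bullet> D 1 t)) (at t within I)"
      by (auto intro: has_vector_derivative_transform[OF t, rotated])
    then have "D 0 t \<bullet> D 1 t = 0"
      using vector_derivative_unique_within[OF I[OF t] _ has_vector_derivative_const] by fastforce
    then have "velocity I p t sums 0"
      using sums_mult[OF inner_ell2_sums[of "D 0 t" "D 1 t"], of 2]
      by (simp add: velocity[OF t, abs_def])
    moreover have "summable (\<lambda>n. \<bar>velocity I p t n\<bar>)"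
    proof -
      have "summable (\<lambda>n. \<bar>seq (D 0 t) n\<bar> * \<bar>seq (D 1 t) n\<bar>)"
        by (rule ell2_mult_summable) (simp_all add: seq_summable)
      then show ?thesis
        using summable_mult[of _ 2] by (fastforce simp: velocity[OF t] abs_mult)
    qed
    \<comment> \<open>The quotient is twice an entry of \<open>D 1 t\<close>, which lies in
      \<open>ell2\<close>; this gives the weighted square summability.\<close>
    moreover have "velocity I p t n / sqrt (p t n) = 2 * seq (D 1 t) n" for n
      using pos[OF t, of n] by (simp add: velocity[OF t] seq_D0[OF t, symmetric])
    ultimately show ?thesis
      by (simp add: tangent_space_def sums_iff ell2_scale_summable seq_summable)
  qed
  show "(\<lambda>s. velocity I p s n / p s n) differentiable (at t within I)"
  proof -
    \<comment> \<open>This is the logarithmic derivative of the squared coordinate of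
      \<open>D 0\<close>, whose positivity allows the division.\<close>
    have "\<exists>d. ((\<lambda>s. 2 * seq (D 1 s) n / seq (D 0 s) n) has_real_derivative d) (at t within I)"
      using coord[OF t, of 0 n] coord[OF t, of 1 n] pos[OF t, of n]
      by (auto intro!: derivative_eq_intros)
    then obtain d
      where "((\<lambda>s. 2 * seq (D 1 s) n / seq (D 0 s) n) has_real_derivative d) (at t within I)"
      by blast
    then have "((\<lambda>s. velocity I p s n / p s n) has_real_derivative d) (at t within I)"
    proof (rule has_field_derivative_transform_within[OF _ zero_less_one t])
      fix s assume "s \<in> I"
      then show "2 * seq (D 1 s) n / seq (D 0 s) n = velocity I p s n / p s n"
        using pos[of s n] by (simp add: velocity p_eq power2_eq_square)
    qed
    then show ?thesis
      unfolding real_differentiable_def by blast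
  qed
qed

text \<open>The acceleration is \<open>p t n\<close> times the deviation of the \<open>n\<close>-th
  derivative from the mean under the probability weights \<open>p t\<close>, which are
  positive.\<close>

lemma e_acceleration_eq_0_iff:
  assumes "p t \<in> l2_simplex"
  shows "(\<forall>n. e_acceleration I p t n = 0) \<longleftrightarrow>
    (\<forall>n. vector_derivative (\<lambda>s. velocity I p s n / p s n) (at t within I) =
         vector_derivative (\<lambda>s. velocity I p s 0 / p s 0) (at t within I))"
proof -
  define D where "D = (\<lambda>k. vector_derivative (\<lambda>s. velocity I p s k / p s k) (at t within I))"
  have pos: "p t n \<noteq> 0" for n
    using l2_simplexD(3)[OF assms, of n] by simp
  have acc: "e_acceleration I p t n = p t n * (D n - (\<Sum>k. p t k * D k))" for n
    by (simp add: e_acceleration_def D_def)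
  have "(\<forall>n. e_acceleration I p t n = 0) \<longleftrightarrow> (\<forall>n. D n = D 0)"
  proof
    assume "\<forall>n. D n = D 0"
    then have "(\<Sum>k. p t k * D k) = (\<Sum>k. p t k * D 0)"
      by (metis (no_types))
    also have "\<dots> = D 0"
      using sums_mult2[OF l2_simplexD(2)[OF assms], of "D 0"] by (simp add: sums_iff)
    finally show "\<forall>n. e_acceleration I p t n = 0"
      using \<open>\<forall>n. D n = D 0\<close> unfolding acc by (metis diff_self mult_zero_right)
  next
    assume "\<forall>n. e_acceleration I p t n = 0"
    \<comment> \<open>The sum is a single number independent of \<open>n\<close>, so all
      \<open>D n\<close> agree.\<close>
    then have "D n = (\<Sum>k. p t k * D k)" for n
      using pos[of n] unfolding acc by (metis eq_iff_diff_eq_0 mult_eq_0_iff)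
    then show "\<forall>n. D n = D 0"
      by metis
  qed
  then show ?thesis
    by (simp only: D_def)
qed

text \<open>The denominator is \<open>4 * p0 n\<close> because the metric carries the factor 1/4. A
  second point in \<open>I\<close> makes derivatives within \<open>I\<close> unique at every
  time.\<close>

theorem corollary3p7:
  fixes c :: ell2
    and p0 :: "nat \<Rightarrow> real"
    and I :: "real set"
    and p :: "real \<Rightarrow> nat \<Rightarrow> real"
  assumes "p0 \<in> l2_simplex"
    and "is_interval I" and "0 \<in> I" and "\<exists>t\<in>I. t \<noteq> 0"
    and "smooth_curve I p" and "p 0 = p0"
  shows "gradient_flow_line (linear_functional c) I p0 p \<longleftrightarrow>
    (\<exists>v\<in>tangent_space p0. e_geodesic I p0 v p \<and>
       (\<exists>l::real. \<forall>n. seq c n = v n / (4 * p0 n) + l))"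
proof -
  have I: "at t within I \<noteq> bot" if "t \<in> I" for t
    using at_within_interval_neq_bot[OF assms(2,3) _ _ that] assms(4) by force
  have simplex: "p t \<in> l2_simplex" if "t \<in> I" for t
    using assms(5) that by (simp add: smooth_curve_def)
  note velocity = smooth_curve_velocity[OF assms(5) I]
  \<comment> \<open>\<open>f n\<close> is the logarithmic derivative of the \<open>n\<close>-th
    entry; both sides become conditions on the differences of \<open>f n\<close> and
    \<open>f 0\<close>.\<close>
  define f where "f = (\<lambda>n t. velocity I p t n / p t n)"
  have f: "(f n has_vector_derivative vector_derivative (f n) (at t within I)) (at t within I)"
    if "t \<in> I" for n t
    using velocity(2)[OF _ that] unfolding f_def by (simp add: vector_derivative_works)
  \<comment> \<open>Smoothness already makes the velocity tangent. The constant \<open>l\<close> may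
    vary with \<open>t\<close>.\<close>
  have flow: "gradient_flow_line (linear_functional c) I p0 p \<longleftrightarrow>
      (\<forall>t\<in>I. \<exists>l. \<forall>n. seq c n = f n t / 4 + l)"
    using velocity(1) assms(6)
    by (simp add: gradient_flow_line_def is_gradient_linear_functional_iff simplex f_def mult.commute)
  have acceleration: "(\<forall>n. e_acceleration I p t n = 0) \<longleftrightarrow>
      (\<forall>n. vector_derivative (f n) (at t within I) = vector_derivative (f 0) (at t within I))"
    if "t \<in> I" for t
    using e_acceleration_eq_0_iff[of p t I] simplex[OF that] by (simp only: f_def)
  \<comment> \<open>The witness \<open>v\<close> can only be the velocity at time 0.\<close>
  have geodesic: "(\<exists>v\<in>tangent_space p0. e_geodesic I p0 v p \<and>
       (\<exists>l::real. \<forall>n. seq c n = v n / (4 * p0 n) + l)) \<longleftrightarrow>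
      (\<forall>t\<in>I. \<forall>n. vector_derivative (f n) (at t within I) = vector_derivative (f 0) (at t within I))
      \<and> (\<exists>l. \<forall>n. seq c n = f n 0 / 4 + l)"
    using velocity(1)[OF _ assms(3)] acceleration assms(6)
    by (auto simp: e_geodesic_def f_def mult.commute)
  show ?thesis
    unfolding flow geodesic
  proof (intro iffI conjI ballI allI)
    fix t n
    assume L: "\<forall>t\<in>I. \<exists>l. \<forall>n. seq c n = f n t / 4 + l" and t: "t \<in> I"
    \<comment> \<open>Subtracting the equation at index 0 removes \<open>l\<close> and leaves a
      difference constant in time.\<close>
    have "f n s = f 0 s + 4 * (seq c n - seq c 0)" if s: "s \<in> I" for s
    proof -
      obtain l where "\<forall>n. seq c n = f n s / 4 + l"
        using L s by blast
      then show ?thesis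
        by simp
    qed
    moreover have "((\<lambda>s. f 0 s + 4 * (seq c n - seq c 0)) has_vector_derivative
        vector_derivative (f 0) (at t within I)) (at t within I)"
      using f[OF t, of 0] by (auto intro!: derivative_eq_intros)
    ultimately have "(f n has_vector_derivative vector_derivative (f 0) (at t within I)) (at t within I)"
      by (rule has_vector_derivative_transform[OF t])
    then show "vector_derivative (f n) (at t within I) = vector_derivative (f 0) (at t within I)"
      by (rule vector_derivative_within[OF I[OF t]])
  next
    assume "\<forall>t\<in>I. \<exists>l. \<forall>n. seq c n = f n t / 4 + l"
    then show "\<exists>l. \<forall>n. seq c n = f n 0 / 4 + l"
      using assms(3) by blast
  next
    fix t
    assume "(\<forall>t\<in>I. \<forall>n. vector_derivative (f n) (at t within I) =
        vector_derivative (f 0) (at t within I)) \<and> (\<exists>l. \<forall>n. seq c n = f n 0 / 4 + l)"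
      and t: "t \<in> I"
    then obtain l where l: "\<And>n. seq c n = f n 0 / 4 + l"
      and eq: "\<And>t n. t \<in> I \<Longrightarrow>
        vector_derivative (f n) (at t within I) = vector_derivative (f 0) (at t within I)"
      by blast
    \<comment> \<open>The difference has derivative 0 on the convex set \<open>I\<close>, which
      contains 0 and \<open>t\<close>.\<close>
    have diff: "f n t - f 0 t = f n 0 - f 0 0" for n
    proof -
      have "((\<lambda>s. f n s - f 0 s) has_vector_derivative 0) (at s within I)" if "s \<in> I" for s
        using has_vector_derivative_diff[OF f[OF that, of n] f[OF that, of 0]] eq[OF that, of n]
        by simp
      moreover have "convex I"
        using assms(2) by (simp add: is_interval_convex_1)
      ultimately show ?thesis
        using has_vector_derivative_zero_constant[of I "\<lambda>s. f n s - f 0 s"] t assms(3) by metis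
    qed
    \<comment> \<open>The change of \<open>f 0\<close> between times 0 and \<open>t\<close> is
      common to all \<open>n\<close> and is absorbed into the constant.\<close>
    have "seq c n = f n t / 4 + (l + (f 0 0 - f 0 t) / 4)" for n
      using l[of n] diff[of n] by (simp add: field_simps)
    then show "\<exists>l. \<forall>n. seq c n = f n t / 4 + l"
      by blast
  qed
qed

end
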